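(* For every $b\ge 0$ and every $0<\gamma<\frac18$ there exist a positive integer $n_{b,\gamma}$ and $0<\delta<1$ such that if $n>n_{b,\gamma}$ and $\mathcal D$ is a degree sequence of length $n$ with $M_{\mathcal D}\le b$, then the probability that $G(\mathcal D)$ has a component of order at least $\gamma n$ lies between $\delta$ and $1-\delta$.
   Context: A degree sequence $\mathcal D=(d_1,\dots,d_n)$ consists of positive integers (no zero entries); $G(\mathcal D)$ denotes a uniformly random simple graph on $\{1,\dots,n\}$ in which vertex $i$ has degree $d_i$ (the sequence is assumed to be realizable by some simple graph). $M_{\mathcal D}=\sum_{i:d_i\ne 2}d_i$. The order of a component is its number of vertices. *)

theory Defs
  imports "HOL-Probability.Probability"
begin

text \<open>A simple graph on the vertex set \<open>{1..n}\<close> is its adjacency relation: symmetric, irreflexive,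
  and contained in \<open>{1..n} \<times> {1..n}\<close>. These relations correspond bijectively to edge sets of
  unordered pairs, so counting them counts labelled simple graphs.\<close>

definition simple_graph :: "nat \<Rightarrow> (nat \<times> nat) set \<Rightarrow> bool" where
  "simple_graph n E \<longleftrightarrow> E \<subseteq> {1..n} \<times> {1..n} \<and> sym E \<and> irrefl E"

definition vertex_degree :: "(nat \<times> nat) set \<Rightarrow> nat \<Rightarrow> nat" where
  "vertex_degree E v = card (E `` {v})"

text \<open>The sequence \<open>(d\<^sub>1, \<dots>, d\<^sub>n)\<close> is a function \<open>d\<close> together with its length \<open>n\<close>; the values of
  \<open>d\<close> outside \<open>{1..n}\<close> play no role.\<close>

definition graphs_with_degrees :: "nat \<Rightarrow> (nat \<Rightarrow> nat) \<Rightarrow> (nat \<times> nat) set set" where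
  "graphs_with_degrees n d = {E. simple_graph n E \<and> (\<forall>i\<in>{1..n}. vertex_degree E i = d i)}"

definition degree_sequence :: "nat \<Rightarrow> (nat \<Rightarrow> nat) \<Rightarrow> bool" where
  "degree_sequence n d \<longleftrightarrow> (\<forall>i\<in>{1..n}. d i > 0) \<and> graphs_with_degrees n d \<noteq> {}"

definition M_deg :: "nat \<Rightarrow> (nat \<Rightarrow> nat) \<Rightarrow> nat" where
  "M_deg n d = (\<Sum>i | i \<in> {1..n} \<and> d i \<noteq> 2. d i)"

lemma finite_graphs_with_degrees: "finite (graphs_with_degrees n d)"
  by (rule finite_subset[of _ "Pow ({1..n} \<times> {1..n})"])
     (auto simp: graphs_with_degrees_def simple_graph_def)

text \<open>Uniform, since \<open>graphs_with_degrees n d\<close> is finite and, for a degree sequence, nonempty.\<close>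

definition random_graph :: "nat \<Rightarrow> (nat \<Rightarrow> nat) \<Rightarrow> (nat \<times> nat) set pmf" where
  "random_graph n d = pmf_of_set (graphs_with_degrees n d)"

text \<open>Components are given by their vertex sets, so the order of a component is its cardinality.
  For a simple graph on \<open>{1..n}\<close>, the relation \<open>E\<^sup>*\<close> never leads out of \<open>{1..n}\<close>.\<close>

definition graph_components :: "nat \<Rightarrow> (nat \<times> nat) set \<Rightarrow> nat set set" where
  "graph_components n E = {1..n} // E\<^sup>*"

end

theory Submission
  imports Defs
begin

text \<open>Everything is done by switchings, which replace the edges \<open>ab\<close>, \<open>cd\<close> by \<open>ad\<close>, \<open>bc\<close>, and by
  counting the switchings between two classes of graphs from both sides.

  Call a vertex heavy if its component has order at least \<open>k = \<lceil>\<gamma>n\<rceil>\<close> or contains a vertex of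
  degree other than 2. If there are at least \<open>k\<close> heavy vertices, one of them is far away from all
  irregular vertices, so it starts a long path of vertices of degree 2, and there are of order
  \<open>n\<^sup>2\<close> switchings cutting a cycle of linear length, but shorter than \<open>k\<close>, out of that path. There
  are at most of order \<open>n\<^sup>2\<close> switchings at all, so after a bounded number of steps a positive
  proportion of all graphs has fewer than \<open>k\<close> heavy vertices; these have no large component.

  For the other bound, fix a vertex \<open>v\<close> which, in most of these graphs, is not connected to an
  irregular vertex. If the cycle through \<open>v\<close> has length
  less than \<open>k\<close>, it can be merged with other components by switching an edge at \<open>v\<close> in at least
  \<open>4(n - 2k)\<close> ways, while each graph arises in at most \<open>4(2k + 1)\<close> ways, because the second end of
  the switched edge stays within distance \<open>k\<close> of \<open>v\<close>. As \<open>k \<le> n/8\<close>, the cycle through \<open>v\<close> is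
  large in at least half of the cases.\<close>

section \<open>Reachability and closed sets\<close>

lemma rtrancl_Image_eq_of_agree:
  assumes closed: "E `` X \<subseteq> X" and agree: "\<And>y. y \<in> X \<Longrightarrow> F `` {y} = E `` {y}" and "x \<in> X"
  shows "F\<^sup>* `` {x} = E\<^sup>* `` {x}"
proof -
  have 1: "(x, y) \<in> E\<^sup>* \<Longrightarrow> (x, y) \<in> F\<^sup>* \<and> y \<in> X" for y
  proof (induction rule: rtrancl_induct)
    case (step y z)
    then show ?case using agree[of y] closed by (auto intro: rtrancl_into_rtrancl)
  qed (use \<open>x \<in> X\<close> in auto)
  have 2: "(x, y) \<in> F\<^sup>* \<Longrightarrow> (x, y) \<in> E\<^sup>* \<and> y \<in> X" for y
  proof (induction rule: rtrancl_induct)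
    case (step y z)
    then show ?case using agree[of y] closed by (auto intro: rtrancl_into_rtrancl)
  qed (use \<open>x \<in> X\<close> in auto)
  show ?thesis using 1 2 by auto
qed

lemma rtrancl_Image_subset:
  assumes "E `` X \<subseteq> X" "A \<subseteq> X"
  shows "E\<^sup>* `` A \<subseteq> X"
proof -
  have "E\<^sup>* `` X = X" by (rule Image_closed_trancl[OF assms(1)])
  then show ?thesis using Image_mono[OF order_refl assms(2), of "E\<^sup>*"] by simp
qed

lemma card_insert_Diff_eq:
  assumes "finite S" "b \<in> S" "d \<notin> S"
  shows "card (insert d (S - {b})) = card S"
  using assms card_Suc_Diff1[OF assms(1,2)] by simp

section \<open>Switchings and their inverses\<close>

text \<open>Removed and added edges alternate along the 4-cycle \<open>a\<close>, \<open>b\<close>,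
  \<open>c\<close>, \<open>d\<close>, so exchanging \<open>b\<close> and \<open>d\<close> gives the
  inverse move.\<close>

definition switch :: "('a \<times> 'a) set \<Rightarrow> 'a \<Rightarrow> 'a \<Rightarrow> 'a \<Rightarrow> 'a \<Rightarrow> ('a \<times> 'a) set" where
  "switch E a b c d =
    (E - {(a, b), (b, a), (c, d), (d, c)}) \<union> {(a, d), (d, a), (b, c), (c, b)}"

text \<open>The inequalities exclude loops among the new edges; in a simple graph the distinctness
  of all four vertices then follows.\<close>

definition switchable :: "('a \<times> 'a) set \<Rightarrow> 'a \<Rightarrow> 'a \<Rightarrow> 'a \<Rightarrow> 'a \<Rightarrow> bool" where
  "switchable E a b c d \<longleftrightarrow>
    (a, b) \<in> E \<and> (c, d) \<in> E \<and> (a, d) \<notin> E \<and> (b, c) \<notin> E \<and> a \<noteq> d \<and> b \<noteq> c"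

lemma switchable_distinct:
  assumes "sym E" "irrefl E" "switchable E a b c d"
  shows "distinct [a, b, c, d]"
proof -
  have "(a,b) \<in> E" "(b,a) \<in> E" "(c,d) \<in> E" "(d,c) \<in> E" "(a,d) \<notin> E" "(b,c) \<notin> E"
    using assms(3) symD[OF assms(1)] unfolding switchable_def by auto
  moreover have "(x, x) \<notin> E" for x using assms(2) by (simp add: irrefl_def)
  ultimately show ?thesis using assms(3) unfolding switchable_def by auto
qed

lemma switch_switch:
  assumes "sym E" "irrefl E" "switchable E a b c d"
  shows "switch (switch E a b c d) a d c b = E"
proof -
  have "(a,b) \<in> E" "(b,a) \<in> E" "(c,d) \<in> E" "(d,c) \<in> E" "(a,d) \<notin> E" "(d,a) \<notin> E"
    "(b,c) \<notin> E" "(c,b) \<notin> E"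
    using assms(3) symD[OF assms(1)] unfolding switchable_def by auto
  then show ?thesis
    using switchable_distinct[OF assms] unfolding switch_def by auto
qed

lemma switch_Image_outside:
  "u \<notin> {a, b, c, d} \<Longrightarrow> switch E a b c d `` {u} = E `` {u}"
  by (auto simp: switch_def)

lemma switch_Image:
  assumes "sym E" "irrefl E" "switchable E a b c d"
  shows "switch E a b c d `` {a} = insert d (E `` {a} - {b})"
    and "switch E a b c d `` {b} = insert c (E `` {b} - {a})"
    and "switch E a b c d `` {c} = insert b (E `` {c} - {d})"
    and "switch E a b c d `` {d} = insert a (E `` {d} - {c})"
  using switchable_distinct[OF assms] unfolding switch_def by auto

lemma simple_graphD:
  assumes "simple_graph n E"
  shows "E \<subseteq> {1..n} \<times> {1..n}" "sym E" "irrefl E" "finite E" "\<And>A. finite (E `` A)"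
proof -
  show *: "E \<subseteq> {1..n} \<times> {1..n}" "sym E" "irrefl E"
    using assms by (auto simp: simple_graph_def)
  show "finite E" using *(1) by (rule finite_subset) auto
  show "finite (E `` A)" for A
    by (rule finite_subset[of _ "{1..n}"]) (use *(1) in auto)
qed

lemma graphs_with_degreesD:
  assumes "E \<in> graphs_with_degrees n d"
  shows "simple_graph n E" "\<And>u. u \<in> {1..n} \<Longrightarrow> card (E `` {u}) = d u"
  using assms by (auto simp: graphs_with_degrees_def vertex_degree_def)

lemma switch_graphs_with_degrees:
  assumes E: "E \<in> graphs_with_degrees n D" and s: "switchable E a b c d"
  shows "switch E a b c d \<in> graphs_with_degrees n D"
proof -
  note sg = graphs_with_degreesD(1)[OF E]
  note sgD = simple_graphD[OF sg]
  note di = switchable_distinct[OF sgD(2,3) s]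
  have ab: "(a,b) \<in> E" "(b,a) \<in> E" "(c,d) \<in> E" "(d,c) \<in> E" "(a,d) \<notin> E" "(d,a) \<notin> E"
     "(b,c) \<notin> E" "(c,b) \<notin> E"
    using s sgD(2) by (auto simp: switchable_def dest: symD)
  have "switch E a b c d \<subseteq> {1..n} \<times> {1..n}"
    using sgD(1) ab(1-4) unfolding switch_def by blast
  moreover have "sym (switch E a b c d)"
    by (rule symI) (use symD[OF sgD(2)] in \<open>auto simp: switch_def\<close>)
  moreover have "irrefl (switch E a b c d)"
    using sgD(3) di by (auto simp: switch_def irrefl_def)
  ultimately have "simple_graph n (switch E a b c d)"
    by (simp add: simple_graph_def)
  moreover have "card (switch E a b c d `` {u}) = card (E `` {u})" for u
  proof (cases "u \<in> {a,b,c,d}")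
    case True
    have *: "card (insert y (E `` {z} - {x})) = card (E `` {z})"
      if "(z, x) \<in> E" "(z, y) \<notin> E" for x y z
      using that by (intro card_insert_Diff_eq sgD(5)) auto
    show ?thesis
      using True *[OF ab(1,5)] *[OF ab(2,7)] *[OF ab(3,8)] *[OF ab(4,6)]
        switch_Image[OF sgD(2,3) s] by auto
  qed (simp add: switch_Image_outside)
  ultimately show ?thesis
    using E by (auto simp: graphs_with_degrees_def vertex_degree_def)
qed

text \<open>\<open>F\<close> lists the moves out of a graph, \<open>R\<close> contains every move
  that can lead to it. Since \<open>\<psi> t\<close> undoes \<open>\<phi> t\<close>, the pairs of a
  graph in \<open>A\<close> and a move inject into the corresponding pairs over
  \<open>B\<close>.\<close>

lemma double_counting:
  assumes fin: "finite A" "finite B"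
    and F: "\<And>E. E \<in> A \<Longrightarrow> finite (F E) \<and> f \<le> card (F E)"
    and R: "\<And>H. H \<in> B \<Longrightarrow> finite (R H) \<and> card (R H) \<le> r"
    and step: "\<And>E t. E \<in> A \<Longrightarrow> t \<in> F E \<Longrightarrow> \<phi> t E \<in> B \<and> t \<in> R (\<phi> t E) \<and> \<psi> t (\<phi> t E) = E"
  shows "card A * f \<le> card B * r"
proof -
  have "card A * f \<le> (\<Sum>E\<in>A. card (F E))"
    using F sum_bounded_below[of A f "\<lambda>E. card (F E)"] by simp
  also have "\<dots> = card (Sigma A F)"
    using F fin by (simp add: card_SigmaI)
  also have "\<dots> \<le> card (Sigma B R)"
  proof (rule card_inj_on_le)
    show "inj_on (\<lambda>(E, t). (\<phi> t E, t)) (Sigma A F)"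
      by (rule inj_on_inverseI[where g = "\<lambda>(H, t). (\<psi> t H, t)"]) (use step in auto)
    show "(\<lambda>(E, t). (\<phi> t E, t)) ` Sigma A F \<subseteq> Sigma B R"
      using step by auto
    show "finite (Sigma B R)"
      using fin R by auto
  qed
  also have "\<dots> = (\<Sum>H\<in>B. card (R H))"
    using R fin by (simp add: card_SigmaI)
  also have "\<dots> \<le> card B * r"
    using R sum_bounded_above[of B "\<lambda>H. card (R H)" r] by simp
  finally show ?thesis .
qed

section \<open>Balls in a graph and their growth\<close>

primrec nbhd :: "('a \<times> 'a) set \<Rightarrow> 'a set \<Rightarrow> nat \<Rightarrow> 'a set" where
  "nbhd E A 0 = A"
| "nbhd E A (Suc j) = nbhd E A j \<union> E `` nbhd E A j"

lemma nbhd_subset_rtrancl: "nbhd E A j \<subseteq> E\<^sup>* `` A"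
  by (induction j) (auto intro: rtrancl_into_rtrancl)

lemma subset_nbhd: "A \<subseteq> nbhd E A j"
  by (induction j) auto

lemma nbhd_mono_graph:
  assumes "\<And>y. y \<in> E\<^sup>* `` A \<Longrightarrow> E `` {y} \<subseteq> F `` {y}"
  shows "nbhd E A j \<subseteq> nbhd F A j"
proof (induction j)
  case (Suc j)
  have "E `` nbhd E A j \<subseteq> F `` nbhd E A j"
    using assms nbhd_subset_rtrancl[of E A j] by blast
  then show ?case using Suc by auto
qed simp

text \<open>A ball that is not closed under \<open>E\<close> gains a vertex at the next radius. If
  radius \<open>k\<close> were too small, no ball up to that radius would be closed, and more than
  \<open>k\<close> vertices would be reached.\<close>

lemma rtrancl_Image_eq_nbhd:
  assumes fin: "finite (E\<^sup>* `` A)" and k: "card (E\<^sup>* `` A) \<le> k"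
  shows "E\<^sup>* `` A = nbhd E A k"
proof (rule ccontr)
  assume neq: "E\<^sup>* `` A \<noteq> nbhd E A k"
  have not_closed: "\<not> E `` nbhd E A j \<subseteq> nbhd E A j" if "j \<le> k" for j
  proof
    assume "E `` nbhd E A j \<subseteq> nbhd E A j"
    then have *: "E\<^sup>* `` A \<subseteq> nbhd E A j"
      by (rule rtrancl_Image_subset) (rule subset_nbhd)
    have "nbhd E A j \<subseteq> nbhd E A k"
      using that by (induction rule: dec_induct) auto
    then show False using * neq nbhd_subset_rtrancl[of E A k] by blast
  qed
  have grow: "j \<le> k \<Longrightarrow> Suc j \<le> card (nbhd E A (Suc j))" for j
  proof (induction j)
    case 0
    have "finite (nbhd E A (Suc 0))"
      using fin nbhd_subset_rtrancl by (rule rev_finite_subset)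
    then show ?case using not_closed[of 0] by (auto simp: Suc_le_eq card_gt_0_iff)
  next
    case (Suc j)
    have "nbhd E A (Suc j) \<subset> nbhd E A (Suc (Suc j))"
      using not_closed[of "Suc j"] Suc.prems by (simp only: nbhd.simps(2)[of E A "Suc j"]) blast
    moreover have "finite (nbhd E A (Suc (Suc j)))"
      using fin nbhd_subset_rtrancl by (rule rev_finite_subset)
    ultimately have "card (nbhd E A (Suc j)) < card (nbhd E A (Suc (Suc j)))"
      by (metis psubset_card_mono)
    then show ?case using Suc by auto
  qed
  have "card (nbhd E A (Suc k)) \<le> card (E\<^sup>* `` A)"
    by (rule card_mono[OF fin nbhd_subset_rtrancl])
  with grow[of k] k show False by simp
qed

text \<open>Growth is linear: the first sphere is bounded by the degree sum of \<open>A\<close>, and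
  no later sphere is larger than its predecessor.\<close>

lemma card_nbhd_le:
  fixes E :: "('a \<times> 'a) set"
  assumes "sym E" and finE: "\<And>x. finite (E `` {x})" and fin: "finite A"
    and deg: "\<And>y. y \<in> E\<^sup>* `` A - A \<Longrightarrow> card (E `` {y}) \<le> 2"
  shows "card (nbhd E A j) \<le> card A + j * (\<Sum>a\<in>A. card (E `` {a}))"
proof -
  define new where "new j = nbhd E A (Suc j) - nbhd E A j" for j
  have finN: "finite (nbhd E A j)" for j
  proof (induction j)
    case (Suc j)
    have "E `` nbhd E A j = (\<Union>x\<in>nbhd E A j. E `` {x})" by auto
    then show ?case using Suc finE by simp
  qed (use fin in auto)
  have finnew: "finite (new j)" for j using finN by (auto simp: new_def simp del: nbhd.simps)
  have new0: "card (new 0) \<le> (\<Sum>a\<in>A. card (E `` {a}))"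
  proof -
    have "card (new 0) \<le> card (\<Union>a\<in>A. E `` {a})"
      by (rule card_mono) (auto simp: new_def fin finE)
    also have "\<dots> \<le> (\<Sum>a\<in>A. card (E `` {a}))"
      by (rule card_UN_le[OF fin])
    finally show ?thesis .
  qed
  text \<open>A newly reached vertex has a neighbour closer to \<open>A\<close>, hence at most one farther away.\<close>
  have newS: "card (new (Suc j)) \<le> card (new j)" for j
  proof -
    have one: "card (E `` {u} \<inter> new (Suc j)) \<le> 1" if u: "u \<in> new j" for u
    proof -
      from u obtain p where p: "p \<in> nbhd E A j" "(p, u) \<in> E" by (auto simp: new_def)
      have "u \<in> E\<^sup>* `` A - A"
        using u nbhd_subset_rtrancl[of E A "Suc j"] subset_nbhd[of A E j] by (auto simp: new_def)
      then have "card (E `` {u}) \<le> 2" by (rule deg)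
      moreover have "p \<in> E `` {u}" using p \<open>sym E\<close> by (auto dest: symD)
      moreover have "E `` {u} \<inter> new (Suc j) \<subseteq> E `` {u} - {p}"
        using p by (auto simp: new_def)
      then have "card (E `` {u} \<inter> new (Suc j)) \<le> card (E `` {u} - {p})"
        by (rule card_mono[rotated]) (simp add: finE)
      ultimately show ?thesis using finE[of u] by simp
    qed
    have "new (Suc j) \<subseteq> (\<Union>u\<in>new j. E `` {u} \<inter> new (Suc j))"
      by (auto simp: new_def)
    then have "card (new (Suc j)) \<le> card (\<Union>u\<in>new j. E `` {u} \<inter> new (Suc j))"
      by (rule card_mono[rotated]) (auto simp: finnew)
    also have "\<dots> \<le> (\<Sum>u\<in>new j. card (E `` {u} \<inter> new (Suc j)))"
      by (rule card_UN_le[OF finnew])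
    also have "\<dots> \<le> (\<Sum>u\<in>new j. 1)"
      by (rule sum_mono) (use one in auto)
    finally show ?thesis by simp
  qed
  have newj: "card (new j) \<le> (\<Sum>a\<in>A. card (E `` {a}))" for j
    by (induction j) (use new0 newS order_trans in blast)+
  show ?thesis
  proof (induction j)
    case (Suc j)
    have "nbhd E A (Suc j) = nbhd E A j \<union> new j" by (auto simp: new_def)
    then have "card (nbhd E A (Suc j)) \<le> card (nbhd E A j) + card (new j)"
      by (metis card_Un_le)
    then show ?case using Suc newj[of j] by simp
  qed simp
qed

text \<open>The handshake lemma for ordered pairs: swapping the coordinates matches ascending with
  descending orientations.\<close>

lemma even_card_sym_irrefl:
  fixes E :: "('a::linorder \<times> 'a) set"
  assumes "sym E" "irrefl E" "finite E"
  shows "even (card E)"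
proof -
  let ?L = "{e \<in> E. fst e < snd e}" and ?R = "{e \<in> E. snd e < fst e}"
  have "bij_betw prod.swap ?L ?R"
    by (rule bij_betwI[where g = prod.swap]) (use assms(1) in \<open>auto dest: symD\<close>)
  then have "card ?L = card ?R" by (rule bij_betw_same_card)
  moreover have "E = ?L \<union> ?R" using assms(2) by (auto simp: irrefl_def) (metis linorder_less_linear)
  then have "card E = card ?L + card ?R"
    using assms(3) by (metis (mono_tags, lifting) card_Un_disjoint disjoint_iff finite_Un mem_Collect_eq order_less_asym)
  ultimately show ?thesis by simp
qed

section \<open>Heavy vertices and their components\<close>

definition irregular :: "nat \<Rightarrow> (nat \<Rightarrow> nat) \<Rightarrow> nat set" where
  "irregular n d = {i. i \<in> {1..n} \<and> d i \<noteq> 2}"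

definition heavy :: "nat \<Rightarrow> (nat \<Rightarrow> nat) \<Rightarrow> nat \<Rightarrow> (nat \<times> nat) set \<Rightarrow> nat set" where
  "heavy n d k E = {x \<in> {1..n}. k \<le> card (E\<^sup>* `` {x}) \<or> E\<^sup>* `` {x} \<inter> irregular n d \<noteq> {}}"

lemma finite_irregular [simp]: "finite (irregular n d)"
  by (simp add: irregular_def)

lemma finite_heavy [simp]: "finite (heavy n d k E)"
  by (simp add: heavy_def)

lemma card_regular_neighbours:
  assumes "E \<in> graphs_with_degrees n d" "x \<in> {1..n} - irregular n d"
  shows "card (E `` {x}) = 2"
  using graphs_with_degreesD(2)[OF assms(1), of x] assms(2) by (auto simp: irregular_def)

lemma rtrancl_Image_eq_of_sym:
  assumes "sym E" "(x, y) \<in> E\<^sup>*"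
  shows "E\<^sup>* `` {x} = E\<^sup>* `` {y}"
proof -
  have "(y, x) \<in> E\<^sup>*" using assms by (meson sym_rtrancl symD)
  then show ?thesis using assms(2) by (auto intro: rtrancl_trans)
qed

lemma rtrancl_Image_subset_vertices:
  assumes "simple_graph n E" "x \<in> {1..n}"
  shows "E\<^sup>* `` {x} \<subseteq> {1..n}"
  by (rule rtrancl_Image_subset) (use simple_graphD(1)[OF assms(1)] assms(2) in auto)

lemma heavy_rtrancl:
  assumes "simple_graph n E" "x \<in> heavy n d k E" "(x, y) \<in> E\<^sup>*"
  shows "y \<in> heavy n d k E"
proof -
  have "x \<in> {1..n}" using assms(2) by (simp add: heavy_def)
  then have "y \<in> {1..n}" using rtrancl_Image_subset_vertices[OF assms(1)] assms(3) by blast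
  then show ?thesis
    using assms(2) rtrancl_Image_eq_of_sym[OF simple_graphD(2)[OF assms(1)] assms(3)]
    by (simp add: heavy_def)
qed

lemma card_2_eq_doubleton:
  assumes "card S = 2" "a \<in> S" "b \<in> S" "a \<noteq> b"
  shows "S = {a, b}"
proof -
  have "finite S" using assms(1) by (intro card_ge_0_finite) simp
  then show ?thesis using card_subset_eq[of S "{a, b}"] assms by auto
qed

section \<open>Cutting cycles out of long regular paths\<close>

text \<open>Injectivity makes the two path neighbours distinct, and degree 2 leaves no room for a
  third; no chord starts at an interior vertex.\<close>

lemma path_neighbours:
  fixes p :: "nat \<Rightarrow> nat"
  assumes E: "E \<in> graphs_with_degrees n d" and inj: "inj_on p {..r}"
    and edge: "\<And>i. i < r \<Longrightarrow> (p i, p (Suc i)) \<in> E"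
    and reg: "p m \<in> {1..n} - irregular n d" and m: "0 < m" "m < r"
  shows "E `` {p m} = {p (m - 1), p (Suc m)}"
proof (rule card_2_eq_doubleton)
  show "card (E `` {p m}) = 2" by (rule card_regular_neighbours[OF E reg])
  have "(p (m - 1), p m) \<in> E" using edge[of "m - 1"] m by simp
  then show "p (m - 1) \<in> E `` {p m}"
    using simple_graphD(2)[OF graphs_with_degreesD(1)[OF E]] by (auto dest: symD)
  show "p (Suc m) \<in> E `` {p m}" using edge m by auto
  show "p (m - 1) \<noteq> p (Suc m)" 
  proof
    assume "p (m - 1) = p (Suc m)"
    then have "m - 1 = Suc m" using inj m by (auto dest: inj_onD)
    then show False by simp
  qed
qed

text \<open>The path can always be prolonged: otherwise its vertices would form a whole component, and this
  component would be too small and too regular to be heavy.\<close>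

lemma heavy_path_exists:
  assumes E: "E \<in> graphs_with_degrees n d" and x: "x \<in> heavy n d k E"
    and far: "x \<notin> nbhd E (irregular n d) r" and rk: "r + 1 < k"
  shows "\<exists>p. inj_on p {..r} \<and> p 0 = x \<and> (\<forall>i<r. (p i, p (Suc i)) \<in> E) \<and>
    (\<forall>i\<le>r. p i \<in> {1..n} - irregular n d)"
proof -
  note sgD = simple_graphD[OF graphs_with_degreesD(1)[OF E]]
  \<comment> \<open>One step along an edge approaches the irregular vertices by at most one, so the
    excluded radius shrinks with the position on the path.\<close>
  have "L \<le> r \<Longrightarrow> \<exists>p. inj_on p {..L} \<and> p 0 = x \<and> (\<forall>i<L. (p i, p (Suc i)) \<in> E) \<and>
    (\<forall>i\<le>L. p i \<in> {1..n} \<and> p i \<notin> nbhd E (irregular n d) (r - i))" for L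
  proof (induction L)
    case 0
    show ?case using far x by (intro exI[of _ "\<lambda>_. x"]) (auto simp: heavy_def)
  next
    case (Suc L)
    then obtain p where inj: "inj_on p {..L}" and p0: "p 0 = x"
      and edge: "\<And>i. i < L \<Longrightarrow> (p i, p (Suc i)) \<in> E"
      and pn: "\<And>i. i \<le> L \<Longrightarrow> p i \<in> {1..n} \<and> p i \<notin> nbhd E (irregular n d) (r - i)"
      by fastforce
    have reg: "p i \<in> {1..n} - irregular n d" if "i \<le> L" for i
      using pn[OF that] subset_nbhd by fastforce
    have two: "card (E `` {p i}) = 2" if "i \<le> L" for i
      by (rule card_regular_neighbours[OF E reg[OF that]])
    have nbr: "E `` {p i} = {p (i - 1), p (Suc i)}" if "0 < i" "i < L" for i
      using path_neighbours[OF E inj edge reg] that by simp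
    have "\<not> E `` {p L} \<subseteq> p ` {..L}"
    proof
      assume sub: "E `` {p L} \<subseteq> p ` {..L}"
      have ne: "p L \<notin> E `` {p L}" using sgD(3) by (auto simp: irrefl_def)
      have "L \<noteq> 0"
      proof
        assume "L = 0"
        then have "E `` {p L} \<subseteq> {p L}" using sub by simp
        then have "E `` {p L} = {}" using ne by blast
        then show False using two[of L] by simp
      qed
      have pre: "p (L - 1) \<in> E `` {p L}"
        using edge[of "L - 1"] \<open>L \<noteq> 0\<close> sgD(2) by (auto dest: symD)
      have "E `` {p L} \<noteq> {p (L - 1)}" using two[of L] by auto
      then obtain q where q: "q \<in> E `` {p L}" "q \<noteq> p (L - 1)" using pre by blast
      then obtain i where i: "i \<le> L" "q = p i" using sub by auto
      have iL: "i \<noteq> L" "i \<noteq> L - 1" using q ne i by auto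
      have Lq: "p L \<in> E `` {p i}" using q i sgD(2) by (auto dest: symD)
      \<comment> \<open>An interior vertex already has both its neighbours on the path, so the
        second neighbour of \<open>p L\<close> can only be the starting vertex: the path closes up
        to a cycle.\<close>
      have "i = 0"
      proof (rule ccontr)
        assume "i \<noteq> 0"
        then have "p L = p (i - 1) \<or> p L = p (Suc i)" using nbr[of i] Lq i iL by auto
        then have "L = i - 1 \<or> L = Suc i" using inj i iL by (auto dest: inj_onD)
        then show False using \<open>i \<noteq> 0\<close> i iL by auto
      qed
      have "E `` {p 0} = {p 1, p L}"
      proof (rule card_2_eq_doubleton)
        show "card (E `` {p 0}) = 2" using two by simp
        show "p 1 \<in> E `` {p 0}" using edge[of 0] \<open>L \<noteq> 0\<close> by simp
        show "p L \<in> E `` {p 0}" using Lq \<open>i = 0\<close> by simp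
        show "p 1 \<noteq> p L" using inj_onD[OF inj, of 1 L] iL \<open>i = 0\<close> \<open>L \<noteq> 0\<close> by auto
      qed
      then have cl: "E `` {p j} \<subseteq> p ` {..L}" if "j \<le> L" for j
        using that nbr[of j] sub \<open>L \<noteq> 0\<close> by (cases "j = 0"; cases "j = L") auto
      have comp: "E\<^sup>* `` {x} \<subseteq> p ` {..L}"
        by (rule rtrancl_Image_subset) (use cl p0 in auto)
      then have "card (E\<^sup>* `` {x}) \<le> card (p ` {..L})"
        by (rule card_mono[rotated]) simp
      also have "\<dots> \<le> L + 1" using card_image_le[of "{..L}" p] by simp
      finally have "card (E\<^sup>* `` {x}) < k" using rk Suc.prems by simp
      moreover have "E\<^sup>* `` {x} \<inter> irregular n d = {}" using comp reg by blast
      ultimately show False using x by (simp add: heavy_def)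
    qed
    then obtain q where q: "(p L, q) \<in> E" "q \<notin> p ` {..L}" by blast
    have "q \<notin> nbhd E (irregular n d) (r - Suc L)"
    proof
      assume "q \<in> nbhd E (irregular n d) (r - Suc L)"
      then have "p L \<in> nbhd E (irregular n d) (Suc (r - Suc L))"
        using q(1) sgD(2) by (auto dest: symD)
      then show False using pn[of L] Suc.prems by (simp add: Suc_diff_Suc del: nbhd.simps)
    qed
    moreover have "q \<in> {1..n}" using q(1) sgD(1) by auto
    ultimately have pq: "(p(Suc L := q)) i \<in> {1..n} \<and> (p(Suc L := q)) i \<notin> nbhd E (irregular n d) (r - i)"
      if "i \<le> Suc L" for i
      using pn[of i] that by (auto simp: le_Suc_eq)
    show ?case
    proof (intro exI[of _ "p(Suc L := q)"] conjI)
      show "inj_on (p(Suc L := q)) {..Suc L}"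
        using inj q(2) by (auto simp: inj_on_def)
      show "\<forall>i<Suc L. ((p(Suc L := q)) i, (p(Suc L := q)) (Suc i)) \<in> E"
        using edge q(1) by (auto simp: less_Suc_eq)
      show "(p(Suc L := q)) 0 = x" using p0 by simp
      show "\<forall>i\<le>Suc L. (p(Suc L := q)) i \<in> {1..n} \<and>
          (p(Suc L := q)) i \<notin> nbhd E (irregular n d) (r - i)"
        using pq by blast
    qed
  qed
  from this[of r] obtain p where "inj_on p {..r}" "p 0 = x" "\<forall>i<r. (p i, p (Suc i)) \<in> E"
    and pn: "\<forall>i\<le>r. p i \<in> {1..n} \<and> p i \<notin> nbhd E (irregular n d) (r - i)"
    by blast
  moreover have "\<forall>i\<le>r. p i \<in> {1..n} - irregular n d"
    using pn subset_nbhd by fastforce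
  ultimately show ?thesis by blast
qed

text \<open>By symmetry the complement of \<open>X\<close> is closed as well, and the switching
  changes no neighbourhood there.\<close>

lemma switch_rtrancl_Image_outside:
  assumes "sym E" and abcd: "{a, b, c, d} \<subseteq> X" and X: "E `` X \<subseteq> X" and "x \<notin> X"
  shows "(switch E a b c d)\<^sup>* `` {x} = E\<^sup>* `` {x}"
proof (rule rtrancl_Image_eq_of_agree[where X = "- X"])
  show "E `` (- X) \<subseteq> - X" using X \<open>sym E\<close> by (auto dest: symD)
  show "switch E a b c d `` {y} = E `` {y}" if "y \<in> - X" for y
    by (rule switch_Image_outside) (use that abcd in auto)
qed (use \<open>x \<notin> X\<close> in auto)

text \<open>The new edge from \<open>p (Suc i)\<close> to \<open>p j\<close> closes the piece
  between the removed edges to a cycle, and the one from \<open>p i\<close> to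
  \<open>p (Suc j)\<close> bridges the gap. The cycle is regular and has fewer than \<open>k\<close>
  vertices, so it is not heavy; the rest of the old component was heavy before, and other components
  are unchanged.\<close>

lemma cut_path:
  assumes E: "E \<in> graphs_with_degrees n d" and heavy: "p 0 \<in> heavy n d k E"
    and inj: "inj_on p {..r}" and edge: "\<And>i. i < r \<Longrightarrow> (p i, p (Suc i)) \<in> E"
    and reg: "\<And>i. i \<le> r \<Longrightarrow> p i \<in> {1..n} - irregular n d"
    and ij: "0 < i" "i + 3 \<le> j" "Suc j < r" "r < k"
  defines "H \<equiv> switch E (p i) (p (Suc i)) (p j) (p (Suc j))"
  shows "switchable E (p i) (p (Suc i)) (p j) (p (Suc j))"
    and "heavy n d k H \<subseteq> heavy n d k E - p ` {Suc i..j}"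
proof -
  note sg = graphs_with_degreesD(1)[OF E]
  note sgD = simple_graphD[OF sg]
  have peq: "p a = p b \<longleftrightarrow> a = b" if "a \<le> r" "b \<le> r" for a b
    using inj_on_eq_iff[OF inj] that by simp
  have nbr: "E `` {p m} = {p (m - 1), p (Suc m)}" if "0 < m" "m < r" for m
    using path_neighbours[OF E inj edge reg] that by simp
  show sw: "switchable E (p i) (p (Suc i)) (p j) (p (Suc j))"
  proof -
    \<comment> \<open>The cycle cut off has \<open>j - i \<ge> 3\<close> vertices, so its ends are
      not yet adjacent; \<open>0 < i\<close> makes \<open>p i\<close> interior, so both its
      neighbours are known.\<close>
    have "p (Suc j) \<notin> E `` {p i}" "p j \<notin> E `` {p (Suc i)}"
      using ij by (simp_all add: nbr peq)
    then show ?thesis using edge[of i] edge[of j] ij by (auto simp: switchable_def peq)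
  qed
  let ?Z = "p ` {Suc i..j}"
  have HZ: "H `` ?Z \<subseteq> ?Z"
  proof -
    have "H `` {p m} \<subseteq> ?Z" if m: "m \<in> {Suc i..j}" for m
    proof -
      consider "m = Suc i" | "m = j" | "Suc i < m" "m < j" using m by force
      then show ?thesis
      proof cases
        case 1
        have "E `` {p (Suc i)} = {p i, p (Suc (Suc i))}" using nbr[of "Suc i"] ij by simp
        then have "H `` {p m} = insert (p j) ({p i, p (Suc (Suc i))} - {p i})"
          using switch_Image(2)[OF sgD(2,3) sw] 1 by (simp add: H_def)
        then show ?thesis using ij by auto
      next
        case 2
        have "E `` {p j} = {p (j - 1), p (Suc j)}" using nbr[of j] ij by simp
        then have "H `` {p m} = insert (p (Suc i)) ({p (j - 1), p (Suc j)} - {p (Suc j)})"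
          using switch_Image(3)[OF sgD(2,3) sw] 2 by (simp add: H_def)
        then show ?thesis using ij by auto
      next
        case 3
        have "H `` {p m} = E `` {p m}"
          unfolding H_def by (rule switch_Image_outside) (use 3 ij in \<open>auto simp: peq\<close>)
        also have "\<dots> = {p (m - 1), p (Suc m)}" using nbr[of m] 3 ij by simp
        finally have "H `` {p m} = {p (m - 1), p (Suc m)}" .
        moreover have "m - 1 \<in> {Suc i..j}" "Suc m \<in> {Suc i..j}" using 3 by auto
        ultimately show ?thesis by blast
      qed
    qed
    then show ?thesis by blast
  qed
  have reach: "m \<le> r \<Longrightarrow> (p 0, p m) \<in> E\<^sup>*" for m
  proof (induction m)
    case (Suc m)
    then show ?case using edge[of m] by (simp add: rtrancl_into_rtrancl)
  qed simp
  show "heavy n d k H \<subseteq> heavy n d k E - ?Z"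
  proof
    fix x assume x: "x \<in> heavy n d k H"
    have "x \<notin> ?Z"
    proof
      assume "x \<in> ?Z"
      then have sub: "H\<^sup>* `` {x} \<subseteq> ?Z"
        by (intro rtrancl_Image_subset HZ) auto
      then have "card (H\<^sup>* `` {x}) \<le> card ?Z" by (rule card_mono[rotated]) simp
      also have "\<dots> \<le> j - i" using card_image_le[of "{Suc i..j}" p] by simp
      finally have "card (H\<^sup>* `` {x}) < k" using ij by simp
      moreover have "?Z \<inter> irregular n d = {}" using reg ij by auto
      ultimately show False using x sub by (auto simp: heavy_def)
    qed
    moreover have "x \<in> heavy n d k E"
    proof (cases "x \<in> E\<^sup>* `` {p 0}")
      case True
      then show ?thesis using heavy_rtrancl[OF sg heavy] by simp
    next
      case False
      have "H\<^sup>* `` {x} = E\<^sup>* `` {x}" unfolding H_def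
        by (rule switch_rtrancl_Image_outside[where X = "E\<^sup>* `` {p 0}"])
           (use False sgD(2) reach ij in \<open>auto intro: rtrancl_into_rtrancl\<close>)
      then show ?thesis using x by (simp add: heavy_def)
    qed
    ultimately show "x \<in> heavy n d k E - ?Z" by simp
  qed
qed

lemma cut_switches_exist:
  assumes E: "E \<in> graphs_with_degrees n d" and x: "x \<in> heavy n d k E"
    and far: "x \<notin> nbhd E (irregular n d) (4 * s)" and s: "3 \<le> s" "4 * s + 1 < k"
  shows "\<exists>T. finite T \<and> card T = s * s \<and> (\<forall>(a, b, c, e) \<in> T. switchable E a b c e \<and>
    card (heavy n d k (switch E a b c e)) + s \<le> card (heavy n d k E))"
proof -
  from heavy_path_exists[OF E x far s(2)] obtain p where inj: "inj_on p {..4 * s}"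
    and p0: "p 0 = x" and edge: "\<And>i. i < 4 * s \<Longrightarrow> (p i, p (Suc i)) \<in> E"
    and reg: "\<And>i. i \<le> 4 * s \<Longrightarrow> p i \<in> {1..n} - irregular n d"
    by blast
  have peq: "p a = p b \<longleftrightarrow> a = b" if "a \<le> 4 * s" "b \<le> 4 * s" for a b
    using inj_on_eq_iff[OF inj] that by simp
  \<comment> \<open>The position \<open>i\<close> of the first removed edge and the length
    \<open>t\<close> of the cycle take \<open>s\<close> values each. Since \<open>t \<ge> s\<close>,
    every cut removes at least \<open>s\<close> heavy vertices; since
    \<open>i + t + 1 \<le> 3 * s\<close>, it stays inside the path.\<close>
  define I where "I = {1..s} \<times> {s..<2 * s}"
  define g where "g = (\<lambda>(i, t). (p i, p (Suc i), p (i + t), p (Suc (i + t))))"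
  have "inj_on g I"
    by (auto simp: inj_on_def g_def I_def peq)
  then have "card (g ` I) = s * s" by (simp add: card_image I_def)
  moreover have "switchable E a b c e \<and>
      card (heavy n d k (switch E a b c e)) + s \<le> card (heavy n d k E)"
    if "(a, b, c, e) \<in> g ` I" for a b c e
  proof -
    from that obtain i t where it: "1 \<le> i" "i \<le> s" "s \<le> t" "t < 2 * s"
      and abce: "a = p i" "b = p (Suc i)" "c = p (i + t)" "e = p (Suc (i + t))"
      by (auto simp: g_def I_def)
    let ?Z = "p ` {Suc i..i + t}"
    have cut: "switchable E a b c e" "heavy n d k (switch E a b c e) \<subseteq> heavy n d k E - ?Z"
      using cut_path[OF E _ inj edge reg, of k i "i + t"] x p0 it s by (auto simp: abce)
    have sub: "?Z \<subseteq> heavy n d k E"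
    proof -
      have "m \<le> 4 * s \<Longrightarrow> p m \<in> heavy n d k E" for m
      proof (induction m)
        case (Suc m)
        then show ?case
          using edge[of m] heavy_rtrancl[OF graphs_with_degreesD(1)[OF E], of "p m" d k "p (Suc m)"]
          by (simp add: r_into_rtrancl)
      qed (use p0 x in simp)
      then show ?thesis using it by auto
    qed
    have "card ?Z = t"
      using inj_on_subset[OF inj, of "{Suc i..i + t}"] it by (subst card_image) auto
    then have "card (heavy n d k E - ?Z) = card (heavy n d k E) - t"
      using sub by (subst card_Diff_subset) auto
    moreover have "t \<le> card (heavy n d k E)"
      using card_mono[OF finite_heavy sub] \<open>card ?Z = t\<close> by simp
    moreover have "card (heavy n d k (switch E a b c e)) \<le> card (heavy n d k E - ?Z)"
      by (rule card_mono[OF _ cut(2)]) simp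
    ultimately show ?thesis using cut(1) it by simp
  qed
  moreover have "finite (g ` I)" by (simp add: I_def)
  ultimately show ?thesis by (intro exI[of _ "g ` I"]) blast
qed

section \<open>Graphs with few heavy vertices\<close>

lemma sum_irregular_degrees: "(\<Sum>i\<in>irregular n d. d i) = M_deg n d"
  by (simp add: irregular_def M_deg_def)

text \<open>Positivity of the degrees enters here: an isolated vertex would be irregular but
  contribute nothing to the sum.\<close>

lemma card_irregular_le:
  assumes "\<And>i. i \<in> {1..n} \<Longrightarrow> 0 < d i"
  shows "card (irregular n d) \<le> M_deg n d"
proof -
  have "(\<Sum>i\<in>irregular n d. 1) \<le> (\<Sum>i\<in>irregular n d. d i)"
    by (rule sum_mono) (use assms in \<open>auto simp: irregular_def Suc_le_eq\<close>)
  then show ?thesis by (simp add: sum_irregular_degrees)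
qed

text \<open>\<open>E\<close> contains both orientations of every edge, so its cardinality is the
  degree sum.\<close>

lemma card_graph:
  assumes "E \<in> graphs_with_degrees n d"
  shows "card E \<le> 2 * n + M_deg n d"
proof -
  note sgD = simple_graphD[OF graphs_with_degreesD(1)[OF assms]]
  have "E = Sigma {1..n} (\<lambda>i. E `` {i})" using sgD(1) by auto
  then have "card E = card (Sigma {1..n} (\<lambda>i. E `` {i}))" by simp
  also have "\<dots> = (\<Sum>i\<in>{1..n}. d i)"
    using sgD(5) graphs_with_degreesD(2)[OF assms] by (simp add: card_SigmaI)
  also have "\<dots> \<le> (\<Sum>i\<in>{1..n}. 2 + (if d i \<noteq> 2 then d i else 0))"
    by (rule sum_mono) auto
  also have "\<dots> = 2 * n + M_deg n d"
    unfolding M_deg_def sum.distrib by (simp add: sum.inter_filter[symmetric])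
  finally show ?thesis .
qed

text \<open>By linear growth the ball around the irregular vertices has at most
  \<open>M_deg n d * (1 + r)\<close> vertices, too few to contain all heavy ones.\<close>

lemma far_heavy_vertex_exists:
  assumes E: "E \<in> graphs_with_degrees n d" and pos: "\<And>i. i \<in> {1..n} \<Longrightarrow> 0 < d i"
    and k: "M_deg n d * (1 + r) < card (heavy n d k E)"
  shows "\<exists>x. x \<in> heavy n d k E \<and> x \<notin> nbhd E (irregular n d) r"
proof -
  note sgD = simple_graphD[OF graphs_with_degreesD(1)[OF E]]
  have sub: "E\<^sup>* `` irregular n d \<subseteq> {1..n}"
    by (rule rtrancl_Image_subset) (use sgD(1) in \<open>auto simp: irregular_def\<close>)
  have "card (nbhd E (irregular n d) r) \<le>
      card (irregular n d) + r * (\<Sum>a\<in>irregular n d. card (E `` {a}))"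
  proof (rule card_nbhd_le)
    show "card (E `` {y}) \<le> 2" if "y \<in> E\<^sup>* `` irregular n d - irregular n d" for y
      using card_regular_neighbours[OF E, of y] that sub by auto
  qed (use sgD in auto)
  also have "(\<Sum>a\<in>irregular n d. card (E `` {a})) = (\<Sum>a\<in>irregular n d. d a)"
    by (rule sum.cong) (use graphs_with_degreesD(2)[OF E] in \<open>auto simp: irregular_def\<close>)
  also have "card (irregular n d) + r * \<dots> \<le> M_deg n d * (1 + r)"
    using card_irregular_le[of n d, OF pos] by (simp add: sum_irregular_degrees)
  finally have "card (nbhd E (irregular n d) r) < card (heavy n d k E)" using k by simp
  moreover have "finite (nbhd E (irregular n d) r)"
    using nbhd_subset_rtrancl sub by (rule finite_subset[OF subset_trans]) simp
  ultimately have "\<not> heavy n d k E \<subseteq> nbhd E (irregular n d) r"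
    using card_mono by (metis not_le)
  then show ?thesis by blast
qed

text \<open>There are two thresholds because the iteration keeps \<open>k\<close>, which decides
  what is heavy, and varies only the bound \<open>h\<close> on the number of heavy vertices.\<close>

definition light_graphs :: "nat \<Rightarrow> (nat \<Rightarrow> nat) \<Rightarrow> nat \<Rightarrow> nat \<Rightarrow> (nat \<times> nat) set set" where
  "light_graphs n d k h = {E \<in> graphs_with_degrees n d. card (heavy n d k E) < h}"

lemma finite_light_graphs [simp]: "finite (light_graphs n d k h)"
  by (simp add: light_graphs_def finite_graphs_with_degrees)

text \<open>A graph with at least \<open>k\<close> heavy vertices has one far from the irregular
  vertices, hence \<open>s * s\<close> cuts, each lowering the number of heavy vertices by at least
  \<open>s\<close>.\<close>

lemma card_light_graphs_step:
  assumes pos: "\<And>i. i \<in> {1..n} \<Longrightarrow> 0 < d i"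
    and s: "3 \<le> s" "4 * s + 1 < k" "M_deg n d * (1 + 4 * s) < k"
  shows "card (light_graphs n d k (h + s) - light_graphs n d k k) * s\<^sup>2 \<le>
    card (light_graphs n d k h) * (2 * n + M_deg n d)\<^sup>2"
proof -
  let ?A = "light_graphs n d k (h + s) - light_graphs n d k k"
  let ?\<phi> = "\<lambda>(a, b, c, e) E. switch E a b c e"
  define good where "good E T \<longleftrightarrow> finite T \<and> card T = s * s \<and> (\<forall>(a, b, c, e) \<in> T.
    switchable E a b c e \<and> card (heavy n d k (switch E a b c e)) + s \<le> card (heavy n d k E))"
    for E T
  have "\<exists>T. good E T" if "E \<in> ?A" for E
  proof -
    have E: "E \<in> graphs_with_degrees n d" and "k \<le> card (heavy n d k E)"
      using that by (auto simp: light_graphs_def)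
    then obtain x where "x \<in> heavy n d k E" "x \<notin> nbhd E (irregular n d) (4 * s)"
      using far_heavy_vertex_exists[OF E pos, of "4 * s" k] s(3) by auto
    then show ?thesis unfolding good_def using cut_switches_exist[OF E _ _ s(1,2)] by blast
  qed
  then obtain F where F: "\<And>E. E \<in> ?A \<Longrightarrow> good E (F E)" by metis
  \<comment> \<open>A cut producing \<open>H\<close> is determined by the two oriented edges it
    inserted, \<open>(a, e)\<close> and \<open>(b, c)\<close>.\<close>
  define R where "R H = (\<lambda>((a, e), (b, c)). (a, b, c, e)) ` (H \<times> H)" for H :: "(nat \<times> nat) set"
  show ?thesis
  proof (rule double_counting[where F = F and R = R and \<phi> = ?\<phi> and
        \<psi> = "\<lambda>(a, b, c, e) H. switch H a e c b"])
    show "finite (F E) \<and> s\<^sup>2 \<le> card (F E)" if "E \<in> ?A" for E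
      using F[OF that] by (simp add: good_def power2_eq_square)
    show "finite (R H) \<and> card (R H) \<le> (2 * n + M_deg n d)\<^sup>2" if "H \<in> light_graphs n d k h" for H
    proof -
      have H: "H \<in> graphs_with_degrees n d" using that by (simp add: light_graphs_def)
      have fin: "finite (H \<times> H)" using simple_graphD(4)[OF graphs_with_degreesD(1)[OF H]] by simp
      then have "card (R H) \<le> card (H \<times> H)" unfolding R_def by (rule card_image_le)
      also have "\<dots> \<le> (2 * n + M_deg n d)\<^sup>2"
        using card_graph[OF H] by (simp add: power2_eq_square card_cartesian_product mult_mono)
      finally show ?thesis using fin by (simp add: R_def)
    qed
    fix E t assume EA: "E \<in> ?A" and t: "t \<in> F E"
    obtain a b c e where abce: "t = (a, b, c, e)" by (cases t)
    have E: "E \<in> graphs_with_degrees n d" using EA by (simp add: light_graphs_def)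
    note sgD = simple_graphD[OF graphs_with_degreesD(1)[OF E]]
    have sw: "switchable E a b c e"
      and less: "card (heavy n d k (switch E a b c e)) + s \<le> card (heavy n d k E)"
      using F[OF EA] t by (auto simp: good_def abce)
    have "(a, b, c, e) \<in> R (switch E a b c e)"
      unfolding R_def by (rule image_eqI[where x = "((a, e), (b, c))"]) (auto simp: switch_def)
    moreover have "switch E a b c e \<in> light_graphs n d k h"
      using switch_graphs_with_degrees[OF E sw] less EA by (auto simp: light_graphs_def)
    ultimately show "?\<phi> t E \<in> light_graphs n d k h \<and> t \<in> R (?\<phi> t E) \<and>
        (\<lambda>(a, b, c, e) H. switch H a e c b) t (?\<phi> t E) = E"
      using switch_switch[OF sgD(2,3) sw] by (simp add: abce)
  qed auto
qed

text \<open>Each increase of the threshold by \<open>s\<close> costs a factor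
  \<open>(2 * n + M_deg n d)\<^sup>2 / s\<^sup>2 + 1\<close>, where the summand 1 pays for the
  graphs already below \<open>k\<close>. Denominators are cleared to stay in the natural
  numbers.\<close>

lemma card_light_graphs:
  assumes pos: "\<And>i. i \<in> {1..n} \<Longrightarrow> 0 < d i"
    and s: "3 \<le> s" "4 * s + 1 < k" "M_deg n d * (1 + 4 * s) < k"
  shows "card (light_graphs n d k (k + j * s)) * (s\<^sup>2) ^ j \<le>
    card (light_graphs n d k k) * ((2 * n + M_deg n d)\<^sup>2 + s\<^sup>2) ^ j"
proof (induction j)
  case (Suc j)
  let ?L = "light_graphs n d k" and ?q = "(2 * n + M_deg n d)\<^sup>2"
  have "card (?L (k + Suc j * s)) \<le> card (?L (k + j * s + s) - ?L k) + card (?L k)"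
    using card_Un_le[of "?L (k + j * s + s) - ?L k" "?L k"]
      card_mono[of "(?L (k + j * s + s) - ?L k) \<union> ?L k" "?L (k + Suc j * s)"]
    by (auto simp: add_ac)
  also have "card (?L k) \<le> card (?L (k + j * s))"
    by (rule card_mono[OF finite_light_graphs]) (auto simp: light_graphs_def)
  finally have "card (?L (k + Suc j * s)) * s\<^sup>2 \<le>
      card (?L (k + j * s + s) - ?L k) * s\<^sup>2 + card (?L (k + j * s)) * s\<^sup>2"
    by (simp only: add_mult_distrib[symmetric] add_le_cancel_left mult_le_mono1)
  also have "\<dots> \<le> card (?L (k + j * s)) * (?q + s\<^sup>2)"
    using card_light_graphs_step[OF pos s, of "k + j * s"] by (simp add: add_mult_distrib2)
  finally have "card (?L (k + Suc j * s)) * s\<^sup>2 * (s\<^sup>2) ^ j \<le>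
      card (?L (k + j * s)) * (?q + s\<^sup>2) * (s\<^sup>2) ^ j"
    by (rule mult_le_mono1)
  also have "\<dots> = card (?L (k + j * s)) * (s\<^sup>2) ^ j * (?q + s\<^sup>2)"
    by (simp only: mult_ac)
  also have "\<dots> \<le> card (?L k) * (?q + s\<^sup>2) ^ j * (?q + s\<^sup>2)"
    using Suc.IH by (rule mult_le_mono1)
  finally show ?case by (simp add: mult_ac)
qed simp

section \<open>The irregular part and merging the cycle through a root\<close>

definition irregular_part :: "nat \<Rightarrow> (nat \<Rightarrow> nat) \<Rightarrow> (nat \<times> nat) set \<Rightarrow> nat set" where
  "irregular_part n d E = E\<^sup>* `` irregular n d"

lemma irregular_part_subset_vertices:
  assumes "simple_graph n E"
  shows "irregular_part n d E \<subseteq> {1..n}"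
  unfolding irregular_part_def
  by (rule rtrancl_Image_subset) (use simple_graphD(1)[OF assms] in \<open>auto simp: irregular_def\<close>)

lemma irregular_part_subset_heavy:
  assumes "simple_graph n E"
  shows "irregular_part n d E \<subseteq> heavy n d k E"
proof
  fix y assume "y \<in> irregular_part n d E"
  then obtain u where u: "u \<in> irregular n d" "(u, y) \<in> E\<^sup>*" by (auto simp: irregular_part_def)
  have "E\<^sup>* `` {u} = E\<^sup>* `` {y}"
    by (rule rtrancl_Image_eq_of_sym[OF simple_graphD(2)[OF assms] u(2)])
  then have "u \<in> E\<^sup>* `` {y} \<inter> irregular n d" using u(1) by blast
  then show "y \<in> heavy n d k E"
    using irregular_part_subset_vertices[OF assms, of d] \<open>y \<in> irregular_part n d E\<close> by (auto simp: heavy_def)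
qed

lemma rtrancl_Image_disjoint_irregular_part:
  assumes "sym E" "v \<notin> irregular_part n d E"
  shows "E\<^sup>* `` {v} \<inter> irregular_part n d E = {}"
proof -
  have False if "(v, y) \<in> E\<^sup>*" "y \<in> irregular_part n d E" for y
  proof -
    have "(y, v) \<in> E\<^sup>*" using that(1) assms(1) by (meson sym_rtrancl symD)
    then have "v \<in> irregular_part n d E" using that(2) by (auto simp: irregular_part_def intro: rtrancl_trans)
    then show False using assms(2) by simp
  qed
  then show ?thesis by blast
qed

lemma irregular_subset_irregular_part: "irregular n d \<subseteq> irregular_part n d E"
  by (auto simp: irregular_part_def)

text \<open>Otherwise \<open>v\<close> would be the only vertex of odd degree in its component of the graph without
  the edge \<open>vw\<close>.\<close>

lemma not_bridge_of_even_degrees: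
  fixes E :: "('a::linorder \<times> 'a) set"
  assumes E: "sym E" "irrefl E" "finite E" and vw: "(v, w) \<in> E"
    and even: "\<And>u. (v, u) \<in> E\<^sup>* \<Longrightarrow> even (card (E `` {u}))"
  shows "(v, w) \<in> (E - {(v, w), (w, v)})\<^sup>*"
proof (rule ccontr)
  define F where "F = E - {(v, w), (w, v)}"
  define C where "C = F\<^sup>* `` {v}"
  assume "(v, w) \<notin> (E - {(v, w), (w, v)})\<^sup>*"
  then have w: "w \<notin> C" by (simp add: C_def F_def)
  have "C \<subseteq> insert v (F `` UNIV)"
    unfolding C_def by (rule rtrancl_Image_subset) auto
  moreover have finF: "finite (F `` X)" for X using E(3) by (simp add: F_def finite_Image)
  ultimately have finC: "finite C" by (meson finite_insert finite_subset)
  have v: "v \<in> C" by (simp add: C_def)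
  have closed: "F `` C \<subseteq> C" by (auto simp: C_def intro: rtrancl_into_rtrancl)
  \<comment> \<open>This is the edge set of \<open>F\<close> inside \<open>C\<close>. As
    \<open>C\<close> is closed, its cardinality is the sum of the \<open>F\<close>-degrees over
    \<open>C\<close>; these agree with the \<open>E\<close>-degrees except at \<open>v\<close>,
    which has lost one edge.\<close>
  have "even (card (Sigma C (\<lambda>u. F `` {u})))"
  proof (rule even_card_sym_irrefl)
    have "sym F" using E(1) by (auto simp: F_def sym_def)
    then show "sym (Sigma C (\<lambda>u. F `` {u}))"
      using closed by (intro symI) (auto dest: symD)
    show "irrefl (Sigma C (\<lambda>u. F `` {u}))" using E(2) by (auto simp: F_def irrefl_def)
    show "finite (Sigma C (\<lambda>u. F `` {u}))" using finC finF by simp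
  qed
  also have "card (Sigma C (\<lambda>u. F `` {u})) = (\<Sum>u\<in>C. card (F `` {u}))"
    using finC finF by simp
  also have "\<dots> = card (F `` {v}) + (\<Sum>u\<in>C - {v}. card (F `` {u}))"
    by (rule sum.remove[OF finC v])
  also have "(\<Sum>u\<in>C - {v}. card (F `` {u})) = (\<Sum>u\<in>C - {v}. card (E `` {u}))"
  proof (rule sum.cong)
    fix u assume "u \<in> C - {v}"
    then have "F `` {u} = E `` {u}" using w by (auto simp: F_def)
    then show "card (F `` {u}) = card (E `` {u})" by simp
  qed simp
  also have "F `` {v} = E `` {v} - {w}" using vw E(2) by (auto simp: F_def irrefl_def)
  also have "even (card (E `` {v} - {w}) + (\<Sum>u\<in>C - {v}. card (E `` {u}))) \<longleftrightarrow>
      even (card (E `` {v} - {w}))"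
  proof -
    have "even (card (E `` {u}))" if "u \<in> C" for u
    proof (rule even)
      have "F\<^sup>* \<subseteq> E\<^sup>*" by (rule rtrancl_mono) (auto simp: F_def)
      then show "(v, u) \<in> E\<^sup>*" using that by (auto simp: C_def)
    qed
    then have "even (\<Sum>u\<in>C - {v}. card (E `` {u}))" by (intro dvd_sum) auto
    then show ?thesis by simp
  qed
  finally have "even (card (E `` {v} - {w}))" .
  moreover have "Suc (card (E `` {v} - {w})) = card (E `` {v})"
    using vw E(3) by (intro card_Suc_Diff1) (auto simp: finite_Image)
  ultimately show False using even[of v] by (metis even_Suc rtrancl.rtrancl_refl)
qed

text \<open>Merging may create heavy vertices and so leave the light graphs. It cannot enlarge the
  irregular part, so conditions on that part alone give a class that merging preserves.\<close>

definition rooted_graphs :: "nat \<Rightarrow> (nat \<Rightarrow> nat) \<Rightarrow> nat \<Rightarrow> nat \<Rightarrow> (nat \<times> nat) set set" where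
  "rooted_graphs n d k v =
    {E \<in> graphs_with_degrees n d. card (irregular_part n d E) < k \<and> v \<notin> irregular_part n d E}"

lemma finite_rooted_graphs [simp]: "finite (rooted_graphs n d k v)"
  by (simp add: rooted_graphs_def finite_graphs_with_degrees)

text \<open>The switching joins two components free of irregular vertices and so leaves the
  irregular part alone. As all degrees in the component of \<open>v\<close> are 2, the edge
  \<open>vw\<close> is not a bridge, and \<open>w\<close> stays close to \<open>v\<close>; this
  locality limits the number of inverse moves.\<close>

lemma merge_switch:
  assumes E: "E \<in> rooted_graphs n d k v" and v: "v \<in> {1..n}" and small: "card (E\<^sup>* `` {v}) \<le> k"
    and vw: "(v, w) \<in> E" and yx: "(y, x) \<in> E" and y: "y \<notin> irregular_part n d E" "y \<notin> E\<^sup>* `` {v}"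
  shows "switchable E v w y x"
    and "switch E v w y x \<in> rooted_graphs n d k v"
    and "w \<in> nbhd (switch E v w y x) {v} k"
proof -
  have EG: "E \<in> graphs_with_degrees n d" and Ek: "card (irregular_part n d E) < k" "v \<notin> irregular_part n d E"
    using E by (auto simp: rooted_graphs_def)
  note sg = graphs_with_degreesD(1)[OF EG]
  note sgD = simple_graphD[OF sg]
  let ?H = "switch E v w y x" and ?C = "E\<^sup>* `` {v}"
  have w: "w \<in> ?C" using vw by auto
  have "x \<notin> ?C"
  proof
    assume "x \<in> ?C"
    moreover have "(x, y) \<in> E" using yx sgD(2) by (rule symD[rotated])
    ultimately have "y \<in> ?C" by (auto intro: rtrancl_into_rtrancl)
    then show False using y by simp
  qed
  moreover have "(w, y) \<notin> E" using w y(2) by (auto intro: rtrancl_into_rtrancl)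
  ultimately show sw: "switchable E v w y x"
    using vw yx w y(2) by (auto simp: switchable_def)
  have disj: "?C \<inter> irregular_part n d E = {}"
    by (rule rtrancl_Image_disjoint_irregular_part[OF sgD(2) Ek(2)])
  have xk: "x \<notin> irregular_part n d E"
    using rtrancl_Image_disjoint_irregular_part[OF sgD(2) y(1)] yx by blast
  have sub: "irregular_part n d ?H \<subseteq> irregular_part n d E"
    unfolding irregular_part_def[of n d ?H]
  proof (rule rtrancl_Image_subset)
    have "?H `` {u} \<subseteq> irregular_part n d E" if u: "u \<in> irregular_part n d E" for u
    proof -
      have "?H `` {u} = E `` {u}"
        by (rule switch_Image_outside) (use u y(1) xk w disj Ek(2) in auto)
      then show ?thesis using u by (auto simp: irregular_part_def intro: rtrancl_into_rtrancl)
    qed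
    then show "?H `` irregular_part n d E \<subseteq> irregular_part n d E" by blast
  qed (rule irregular_subset_irregular_part)
  have "finite (irregular_part n d E)"
    using irregular_part_subset_vertices[OF sg] by (rule finite_subset) simp
  then have "card (irregular_part n d ?H) \<le> card (irregular_part n d E)" using sub by (rule card_mono)
  then show "?H \<in> rooted_graphs n d k v"
    using switch_graphs_with_degrees[OF EG sw] Ek sub by (auto simp: rooted_graphs_def)
  define F where "F = E - {(v, w), (w, v)}"
  have Csub: "?C \<subseteq> {1..n}" by (rule rtrancl_Image_subset_vertices[OF sg v])
  have "even (card (E `` {u}))" if "(v, u) \<in> E\<^sup>*" for u
  proof -
    have "u \<in> {1..n} - irregular n d"
      using that Csub disj irregular_subset_irregular_part[of n d E] by blast
    then show ?thesis using card_regular_neighbours[OF EG] by simp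
  qed
  then have "(v, w) \<in> F\<^sup>*"
    unfolding F_def by (rule not_bridge_of_even_degrees[OF sgD(2,3,4) vw])
  moreover have FC: "F\<^sup>* `` {v} \<subseteq> ?C"
    by (intro Image_mono rtrancl_mono) (auto simp: F_def)
  \<comment> \<open>At most \<open>k\<close> vertices are reachable from \<open>v\<close>, so
    \<open>k\<close> steps reach them all.\<close>
  have "F\<^sup>* `` {v} = nbhd F {v} k"
  proof (rule rtrancl_Image_eq_nbhd)
    have "finite ?C" using Csub by (rule finite_subset) simp
    then show "finite (F\<^sup>* `` {v})" "card (F\<^sup>* `` {v}) \<le> k"
      using FC small card_mono[of ?C "F\<^sup>* `` {v}"] by (auto intro: finite_subset)
  qed
  \<comment> \<open>Besides \<open>vw\<close>, the switching removes only \<open>yx\<close>, which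
    lies in another component, so these short walks survive.\<close>
  moreover have "nbhd F {v} k \<subseteq> nbhd ?H {v} k"
  proof (rule nbhd_mono_graph)
    fix u assume "u \<in> F\<^sup>* `` {v}"
    then have "u \<noteq> y" "u \<noteq> x" using FC y(2) \<open>x \<notin> ?C\<close> by auto
    then show "F `` {u} \<subseteq> ?H `` {u}" by (auto simp: F_def switch_def)
  qed
  ultimately show "w \<in> nbhd ?H {v} k" by blast
qed

lemma card_rooted_graphs_small_component:
  assumes v: "v \<in> {1..n}" and k: "8 * k \<le> n" "8 \<le> n"
  shows "2 * card {E \<in> rooted_graphs n d k v. card (E\<^sup>* `` {v}) < k} \<le> card (rooted_graphs n d k v)"
proof -
  let ?S = "rooted_graphs n d k v"
  let ?A = "{E \<in> ?S. card (E\<^sup>* `` {v}) < k}"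
  let ?\<phi> = "\<lambda>(w, y, x) E. switch E v w y x"
  \<comment> \<open>There are two neighbours \<open>w\<close> of \<open>v\<close>, at least
    \<open>n - 2 * k\<close> vertices \<open>y\<close> outside the irregular part and the component
    of \<open>v\<close>, and two neighbours \<open>x\<close> of each \<open>y\<close>.\<close>
  define F where
    "F E = E `` {v} \<times> Sigma ({1..n} - irregular_part n d E - E\<^sup>* `` {v}) (\<lambda>y. E `` {y})"
    for E :: "(nat \<times> nat) set"
  \<comment> \<open>In the new graph \<open>x\<close> is one of two neighbours of \<open>v\<close>,
    \<open>w\<close> lies in a ball of at most \<open>1 + 2 * k\<close> vertices, and
    \<open>y\<close> is one of two neighbours of \<open>w\<close>.\<close>
  define R where
    "R H = (\<lambda>(x, w, y). (w, y, x)) ` (H `` {v} \<times> Sigma (nbhd H {v} k) (\<lambda>w. H `` {w}))"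
    for H :: "(nat \<times> nat) set"
  have deg: "card (E `` {u}) = 2" if "E \<in> ?S" "u \<in> {1..n}" "u \<notin> irregular_part n d E" for E u
    using that irregular_subset_irregular_part[of n d E] card_regular_neighbours[of E n d u]
    by (auto simp: rooted_graphs_def)
  have "card ?A * (4 * (n - 2 * k)) \<le> card ?S * (4 * (1 + 2 * k))"
  proof (rule double_counting[where F = F and R = R and \<phi> = ?\<phi> and
        \<psi> = "\<lambda>(w, y, x) H. switch H v x y w"])
    fix E assume EA: "E \<in> ?A"
    then have ES: "E \<in> ?S" and EG: "E \<in> graphs_with_degrees n d"
      and Ek: "card (irregular_part n d E) < k" "v \<notin> irregular_part n d E" by (auto simp: rooted_graphs_def)
    note sgD = simple_graphD[OF graphs_with_degreesD(1)[OF EG]]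
    let ?Y = "{1..n} - irregular_part n d E - E\<^sup>* `` {v}"
    have "card (F E) = card (E `` {v}) * (\<Sum>y\<in>?Y. card (E `` {y}))"
      using sgD(5) unfolding F_def by (simp add: card_cartesian_product)
    also have "\<dots> = 2 * (\<Sum>y\<in>?Y. 2)"
      using deg[OF ES] v Ek(2) by simp
    finally have card: "card (F E) = 4 * card ?Y" by simp
    have "n - card (irregular_part n d E) \<le> card ({1..n} - irregular_part n d E)"
      using diff_card_le_card_Diff[of "irregular_part n d E" "{1..n}"]
        irregular_part_subset_vertices[OF graphs_with_degreesD(1)[OF EG]] finite_subset by fastforce
    moreover have "card ({1..n} - irregular_part n d E) - card (E\<^sup>* `` {v}) \<le> card ?Y"
      using diff_card_le_card_Diff[of "E\<^sup>* `` {v}" "{1..n} - irregular_part n d E"]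
        rtrancl_Image_subset_vertices[OF graphs_with_degreesD(1)[OF EG] v] finite_subset by fastforce
    moreover have "card (E\<^sup>* `` {v}) < k" using EA by simp
    ultimately have "n - 2 * k \<le> card ?Y" using Ek(1) by linarith
    then show "finite (F E) \<and> 4 * (n - 2 * k) \<le> card (F E)"
      using card sgD(5) by (simp add: F_def)
    fix t assume t: "t \<in> F E"
    obtain w y x where wyx: "t = (w, y, x)" by (cases t)
    have *: "(v, w) \<in> E" "(y, x) \<in> E" "y \<notin> irregular_part n d E" "y \<notin> E\<^sup>* `` {v}"
      using t by (auto simp: F_def wyx)
    have small: "card (E\<^sup>* `` {v}) \<le> k" using EA by simp
    note merge = merge_switch[OF ES v small *]
    have "(w, y, x) \<in> R (switch E v w y x)"
      unfolding R_def using merge(3)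
      by (intro image_eqI[where x = "(x, w, y)"]) (auto simp: switch_def)
    then show "?\<phi> t E \<in> ?S \<and> t \<in> R (?\<phi> t E) \<and> (\<lambda>(w, y, x) H. switch H v x y w) t (?\<phi> t E) = E"
      using merge(2) switch_switch[OF sgD(2,3) merge(1)] by (simp add: wyx)
  next
    fix H assume HS: "H \<in> ?S"
    then have HG: "H \<in> graphs_with_degrees n d" and Hv: "v \<notin> irregular_part n d H"
      by (auto simp: rooted_graphs_def)
    note sg = graphs_with_degreesD(1)[OF HG]
    note sgD = simple_graphD[OF sg]
    have Cdeg: "card (H `` {u}) = 2" if "u \<in> H\<^sup>* `` {v}" for u
      using deg[OF HS, of u] that rtrancl_Image_subset_vertices[OF sg v]
        rtrancl_Image_disjoint_irregular_part[OF sgD(2) Hv] by blast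
    have Nsub: "nbhd H {v} k \<subseteq> H\<^sup>* `` {v}" by (rule nbhd_subset_rtrancl)
    have Nfin: "finite (nbhd H {v} k)"
      using Nsub rtrancl_Image_subset_vertices[OF sg v] by (meson finite_atLeastAtMost finite_subset)
    have fin: "finite (H `` {v} \<times> Sigma (nbhd H {v} k) (\<lambda>w. H `` {w}))"
      using Nfin sgD(5) by simp
    have "card (nbhd H {v} k) \<le> card {v} + k * (\<Sum>a\<in>{v}. card (H `` {a}))"
      by (rule card_nbhd_le) (use sgD Cdeg in auto)
    then have Ncard: "card (nbhd H {v} k) \<le> 1 + 2 * k" using Cdeg[of v] by simp
    have "card (R H) \<le> card (H `` {v} \<times> Sigma (nbhd H {v} k) (\<lambda>w. H `` {w}))"
      unfolding R_def using fin by (rule card_image_le)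
    also have "\<dots> = card (H `` {v}) * (\<Sum>w\<in>nbhd H {v} k. card (H `` {w}))"
      using Nfin sgD(5) by (simp add: card_cartesian_product)
    also have "(\<Sum>w\<in>nbhd H {v} k. card (H `` {w})) = (\<Sum>w\<in>nbhd H {v} k. 2)"
      by (rule sum.cong) (use Nsub Cdeg in auto)
    finally have "card (R H) \<le> 4 * card (nbhd H {v} k)" using Cdeg[of v] by simp
    then show "finite (R H) \<and> card (R H) \<le> 4 * (1 + 2 * k)"
      using Ncard fin by (simp add: R_def)
  qed auto
  then have *: "card ?A * (n - 2 * k) \<le> card ?S * (1 + 2 * k)"
    by (simp only: mult.left_commute[of _ 4] nat_mult_le_cancel_disj)
  have "2 * card ?A * (1 + 2 * k) = card ?A * (2 * (1 + 2 * k))" by simp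
  \<comment> \<open>From \<open>6 * k \<le> 3 * n / 4\<close> and \<open>2 \<le> n / 4\<close> it
    follows that \<open>2 * (1 + 2 * k) \<le> n - 2 * k\<close>.\<close>
  also have "\<dots> \<le> card ?A * (n - 2 * k)" using k by (intro mult_le_mono2) simp
  also note *
  finally show ?thesis by (rule mult_right_le_imp_le) simp
qed

section \<open>From a root to large components\<close>

text \<open>By averaging: the irregular part of a light graph consists of heavy vertices, so each
  light graph leaves at least \<open>n - k\<close> of the \<open>n\<close> vertices available as
  roots.\<close>

lemma root_exists:
  assumes "0 < n"
  shows "\<exists>v\<in>{1..n}. card (light_graphs n d k k) * (n - k) \<le> n * card (rooted_graphs n d k v)"
proof (rule ccontr)
  let ?L = "light_graphs n d k k"
  assume "\<not> ?thesis"
  then have less: "n * card (rooted_graphs n d k v) < card ?L * (n - k)" if "v \<in> {1..n}" for v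
    using that by (auto simp: not_le)
  have Lk: "E \<in> graphs_with_degrees n d \<and> card (irregular_part n d E) < k" if "E \<in> ?L" for E
  proof -
    have EG: "E \<in> graphs_with_degrees n d" using that by (simp add: light_graphs_def)
    have "card (irregular_part n d E) \<le> card (heavy n d k E)"
      by (rule card_mono) (use irregular_part_subset_heavy[OF graphs_with_degreesD(1)[OF EG]] in auto)
    then show ?thesis using that EG by (simp add: light_graphs_def)
  qed
  have "card ?L * (n - k) \<le> (\<Sum>E\<in>?L. card {v \<in> {1..n}. v \<notin> irregular_part n d E})"
  proof -
    have "n - k \<le> card {v \<in> {1..n}. v \<notin> irregular_part n d E}" if "E \<in> ?L" for E
    proof -
      have sg: "simple_graph n E" using Lk[OF that] graphs_with_degreesD(1) by blast
      have "{v \<in> {1..n}. v \<notin> irregular_part n d E} = {1..n} - irregular_part n d E" by auto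
      moreover have "finite (irregular_part n d E)"
        using irregular_part_subset_vertices[OF sg] by (rule finite_subset) simp
      ultimately show ?thesis
        using diff_card_le_card_Diff[of "irregular_part n d E" "{1..n}"] Lk[OF that, THEN conjunct2]
        by simp
    qed
    then show ?thesis using sum_bounded_below[of ?L "n - k" "\<lambda>E. card {v \<in> {1..n}. v \<notin> irregular_part n d E}"]
      by simp
  qed
  also have "\<dots> = (\<Sum>v\<in>{1..n}. card {E \<in> ?L. v \<notin> irregular_part n d E})"
    by (rule sum_multicount_gen) auto
  also have "\<dots> \<le> (\<Sum>v\<in>{1..n}. card (rooted_graphs n d k v))"
    by (intro sum_mono card_mono finite_rooted_graphs) (auto simp: rooted_graphs_def dest: Lk)
  finally have "n * (card ?L * (n - k)) \<le> (\<Sum>v\<in>{1..n}. n * card (rooted_graphs n d k v))"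
    by (simp add: sum_distrib_left[symmetric])
  also have "\<dots> < (\<Sum>v\<in>{1..n}. card ?L * (n - k))"
    by (rule sum_strict_mono) (use less assms in auto)
  finally show False by simp
qed

text \<open>One factor 2 comes from the choice of the root, as \<open>n \<le> 2 * (n - k)\<close>;
  the other from the rooted graphs in which the component of the root is small.\<close>

lemma card_light_le_card_large_component:
  assumes k: "8 * k \<le> n" "8 \<le> n"
  shows "card (light_graphs n d k k) \<le>
    4 * card {E \<in> graphs_with_degrees n d. \<exists>v\<in>{1..n}. k \<le> card (E\<^sup>* `` {v})}"
proof -
  let ?L = "light_graphs n d k k"
  obtain v where v: "v \<in> {1..n}" and root: "card ?L * (n - k) \<le> n * card (rooted_graphs n d k v)"
    using root_exists[of n d k] k by auto
  let ?S = "rooted_graphs n d k v"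
  let ?A = "{E \<in> ?S. card (E\<^sup>* `` {v}) < k}"
  let ?B = "{E \<in> graphs_with_degrees n d. \<exists>v\<in>{1..n}. k \<le> card (E\<^sup>* `` {v})}"
  have "card ?L * n \<le> card ?L * (2 * (n - k))" using k by (intro mult_le_mono2) simp
  also have "\<dots> \<le> 2 * card ?S * n" using root by (simp add: mult.commute)
  finally have "card ?L \<le> 2 * card ?S" using k by simp
  moreover have "card ?S \<le> card ?A + card ?B"
  proof -
    have "finite ?B" by (simp add: finite_graphs_with_degrees)
    moreover have "?S \<subseteq> ?A \<union> ?B" using v by (fastforce simp: rooted_graphs_def not_le)
    ultimately show ?thesis
      using card_mono[of "?A \<union> ?B" ?S] card_Un_le[of ?A ?B] by simp
  qed
  ultimately show ?thesis
    using card_rooted_graphs_small_component[OF v k, of d] by linarith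
qed

text \<open>A component with \<open>k\<close> or more vertices consists of heavy vertices only,
  which are then too many.\<close>

lemma no_large_component_of_light:
  assumes "E \<in> light_graphs n d k k" "v \<in> {1..n}"
  shows "card (E\<^sup>* `` {v}) < k"
proof (rule ccontr)
  assume large: "\<not> ?thesis"
  then have v: "v \<in> heavy n d k E" using assms(2) by (simp add: heavy_def)
  have sg: "simple_graph n E"
    using assms(1) graphs_with_degreesD(1) by (auto simp: light_graphs_def)
  have "card (E\<^sup>* `` {v}) \<le> card (heavy n d k E)"
    by (rule card_mono) (use heavy_rtrancl[OF sg v] in auto)
  then show False using assms(1) large by (simp add: light_graphs_def)
qed

section \<open>Choice of constants and the two bounds\<close>

text \<open>After \<open>J\<close> steps of size \<open>s\<close> the threshold exceeds
  \<open>n\<close>, so all graphs are counted. With \<open>2 * n + M_deg n d \<le> 3 * n\<close> and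
  \<open>s \<ge> \<sigma> * n / 2\<close>, each step costs at most the factor
  \<open>36 / \<sigma>\<^sup>2 + 1\<close>.\<close>

lemma card_graphs_le_card_light:
  fixes \<sigma> :: real
  assumes pos: "\<And>i. i \<in> {1..n} \<Longrightarrow> 0 < d i" and M: "M_deg n d \<le> n"
    and \<sigma>: "0 < \<sigma>" "\<sigma> * n / 2 \<le> s" "n \<le> J * s"
    and s: "3 \<le> s" "4 * s + 1 < k" "M_deg n d * (1 + 4 * s) < k"
  shows "real (card (graphs_with_degrees n d)) \<le> card (light_graphs n d k k) * (36 / \<sigma>\<^sup>2 + 1) ^ J"
proof -
  let ?G = "graphs_with_degrees n d" and ?L = "light_graphs n d k k"
  have "card (heavy n d k E) < k + J * s" for E
  proof -
    have "card (heavy n d k E) \<le> card {1..n}" by (rule card_mono) (auto simp: heavy_def)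
    then show ?thesis using \<sigma>(3) s(2) by simp
  qed
  then have G: "light_graphs n d k (k + J * s) = ?G" by (auto simp: light_graphs_def)
  have "real (card ?G) * (real s ^ 2) ^ J \<le> card ?L * (real (2 * n + M_deg n d) ^ 2 + real s ^ 2) ^ J"
    using card_light_graphs[OF pos s, of J, unfolded G, folded of_nat_le_iff[where 'a = real]]
    by simp
  also have "\<dots> \<le> card ?L * ((36 / \<sigma>\<^sup>2 + 1) * real s ^ 2) ^ J"
  proof (intro mult_left_mono power_mono)
    have "real (2 * n + M_deg n d) \<le> 3 * real n" using M by simp
    also have "\<dots> \<le> 6 / \<sigma> * s" using \<sigma>(1,2) by (simp add: field_simps)
    finally have "real (2 * n + M_deg n d) ^ 2 \<le> (6 / \<sigma> * s) ^ 2" by (rule power_mono) simp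
    then show "real (2 * n + M_deg n d) ^ 2 + real s ^ 2 \<le> (36 / \<sigma>\<^sup>2 + 1) * real s ^ 2"
      by (simp add: power_mult_distrib power_divide distrib_right)
  qed simp_all
  also have "\<dots> = card ?L * (36 / \<sigma>\<^sup>2 + 1) ^ J * (real s ^ 2) ^ J"
    by (simp add: power_mult_distrib)
  finally show ?thesis by (rule mult_right_le_imp_le) (use s(1) in simp)
qed

theorem theorem6:
  fixes b \<gamma> :: real
  assumes "b \<ge> 0" and "0 < \<gamma>" and "\<gamma> < 1 / 8"
  shows "\<exists>(N::nat) (\<delta>::real). N > 0 \<and> 0 < \<delta> \<and> \<delta> < 1 \<and>
    (\<forall>(n::nat) (d::nat \<Rightarrow> nat). n > N \<and> degree_sequence n d \<and> real (M_deg n d) \<le> b \<longrightarrow>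
      measure_pmf.prob (random_graph n d)
        {E. \<exists>C\<in>graph_components n E. real (card C) \<ge> \<gamma> * real n} \<in> {\<delta>..1 - \<delta>})"
proof -
  \<comment> \<open>Chosen so that \<open>4 * \<sigma> * n * (b + 1)\<close> is half of
    \<open>\<gamma> * n\<close>; with \<open>s\<close> about \<open>\<sigma> * n\<close> this yields
    both upper bounds on \<open>s\<close> in terms of \<open>k\<close>.\<close>
  define \<sigma> where "\<sigma> = \<gamma> / (8 * (b + 1))"
  define J where "J = nat \<lceil>2 / \<sigma>\<rceil>"
  define Q where "Q = (36 / \<sigma>\<^sup>2 + 1) ^ J"
  \<comment> \<open>At least a fraction \<open>1 / Q\<close> of the graphs is light, and at least a
    quarter of that number has a large component.\<close>
  define \<delta> where "\<delta> = 1 / (4 * Q)"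
  \<comment> \<open>Each summand secures one estimate for large \<open>n\<close>:
    \<open>4 / \<sigma>\<close> absorbs the floor in \<open>s\<close>, the two multiples of
    \<open>1 / \<gamma>\<close> leave room below \<open>k\<close>, \<open>b\<close> gives
    \<open>M_deg n d \<le> n\<close>, and the last one, where \<open>\<gamma> < 1 / 8\<close>
    enters, absorbs the ceiling in \<open>8 * k \<le> n\<close>.\<close>
  define N where "N = nat \<lceil>4 / \<sigma> + 2 / \<gamma> + 2 * b / \<gamma> + b + 8 + 1 / (1 / 8 - \<gamma>)\<rceil>"
  have \<sigma>: "0 < \<sigma>" using assms by (simp add: \<sigma>_def)
  have Q: "1 \<le> Q" unfolding Q_def by (rule one_le_power) simp
  then have \<delta>: "0 < \<delta>" "\<delta> < 1" by (simp_all add: \<delta>_def)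
  have terms: "0 \<le> 4 / \<sigma>" "0 \<le> 2 / \<gamma>" "0 \<le> 2 * b / \<gamma>" "0 \<le> b" "0 \<le> 1 / (1 / 8 - \<gamma>)"
    using assms \<sigma> by simp_all
  have "8 \<le> real N" unfolding N_def using terms by linarith
  then have "0 < N" by simp
  moreover have "measure_pmf.prob (random_graph n d)
        {E. \<exists>C\<in>graph_components n E. real (card C) \<ge> \<gamma> * real n} \<in> {\<delta>..1 - \<delta>}"
    if n: "n > N" and d: "degree_sequence n d" and M: "real (M_deg n d) \<le> b" for n d
  proof -
    define k where "k = nat \<lceil>\<gamma> * n\<rceil>"
    define s where "s = nat \<lfloor>\<sigma> * n\<rfloor>"
    let ?G = "graphs_with_degrees n d" and ?L = "light_graphs n d k k"
    let ?B = "{E \<in> ?G. \<exists>v\<in>{1..n}. k \<le> card (E\<^sup>* `` {v})}"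
    have pos: "0 < d i" if "i \<in> {1..n}" for i using d that by (simp add: degree_sequence_def)
    have "real N < real n" using n by simp
    then have "4 / \<sigma> + 2 / \<gamma> + 2 * b / \<gamma> + b + 8 + 1 / (1 / 8 - \<gamma>) < real n"
      unfolding N_def by linarith
    then have "4 / \<sigma> < n" "2 / \<gamma> < n" "2 * b / \<gamma> < n" "b < n" "8 < real n" "1 / (1 / 8 - \<gamma>) < n"
      using terms by linarith+
    then have n\<sigma>: "4 < \<sigma> * n" and n\<gamma>: "2 < \<gamma> * n" "2 * b < \<gamma> * n" and nb: "b < n" "8 < n"
      and n8: "1 < (1 / 8 - \<gamma>) * n"
      using \<sigma> assms by (simp_all add: field_simps)
    have k: "\<gamma> * n \<le> k" "k < \<gamma> * n + 1" unfolding k_def using n\<gamma> by linarith+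
    have s: "s \<le> \<sigma> * n" "\<sigma> * n < real s + 1" unfolding s_def using n\<sigma> by linarith+
    have "real (8 * k) \<le> real n" using k n8 by (simp add: field_simps)
    then have k8: "8 * k \<le> n" by linarith
    have \<sigma>\<gamma>: "4 * (\<sigma> * n) * (b + 1) = \<gamma> * n / 2"
      using assms by (simp add: \<sigma>_def field_simps)
    have "4 * (\<sigma> * n) * 1 \<le> 4 * (\<sigma> * n) * (b + 1)"
      using n\<sigma> assms by (intro mult_left_mono) simp_all
    then have "4 * (\<sigma> * n) \<le> \<gamma> * n / 2" using \<sigma>\<gamma> by simp
    then have "real (4 * s + 1) < real k" using s k n\<gamma> by simp
    then have s4: "4 * s + 1 < k" by linarith
    have "real (M_deg n d * (1 + 4 * s)) \<le> b * (1 + 4 * (\<sigma> * n))"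
      unfolding of_nat_mult using M s n\<sigma> assms by (intro mult_mono) simp_all
    also have "\<dots> \<le> b + 4 * (\<sigma> * n) * (b + 1)" using n\<sigma> by (simp add: algebra_simps)
    also have "\<dots> < real k" using \<sigma>\<gamma> k n\<gamma> by linarith
    finally have Ms: "M_deg n d * (1 + 4 * s) < k" by linarith
    have "real n = 2 / \<sigma> * (\<sigma> * n / 2)" using \<sigma> by simp
    also have "\<dots> \<le> real J * s"
    proof (intro mult_mono)
      show "2 / \<sigma> \<le> J" unfolding J_def by (rule real_nat_ceiling_ge)
    qed (use s n\<sigma> in simp_all)
    finally have Js: "n \<le> J * s" by (simp flip: of_nat_mult)
    have "real (card ?G) \<le> card ?L * Q"
      unfolding Q_def by (rule card_graphs_le_card_light[OF pos _ \<sigma> _ Js _ s4 Ms])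
        (use M nb s n\<sigma> in linarith)+
    moreover have "real (card ?L) \<le> 4 * card ?B"
      using card_light_le_card_large_component[OF k8, of d] nb by linarith
    moreover have "0 \<le> Q * card ?L" "Q * card ?L \<le> Q * (4 * card ?B)"
      using Q calculation(2) by (simp, intro mult_left_mono, simp_all)
    ultimately have GB: "real (card ?G) \<le> 4 * Q * card ?B"
      and GL: "real (card ?G) \<le> 4 * Q * card ?L"
      by (simp_all only: mult_ac)
    have fin: "finite ?G" "?G \<noteq> {}"
      using d by (simp_all add: finite_graphs_with_degrees degree_sequence_def)
    have ev: "?G \<inter> {E. \<exists>C\<in>graph_components n E. real (card C) \<ge> \<gamma> * real n} = ?B"
      by (auto simp: graph_components_def quotient_def k_def nat_ceiling_le_eq)
    have prob: "measure_pmf.prob (random_graph n d)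
        {E. \<exists>C\<in>graph_components n E. real (card C) \<ge> \<gamma> * real n} = card ?B / card ?G"
      unfolding random_graph_def measure_pmf_of_set[OF fin(2,1)] ev ..
    have G0: "0 < real (card ?G)" using fin by (simp add: card_gt_0_iff)
    have "?L \<inter> ?B = {}" using no_large_component_of_light[of _ n d k] by fastforce
    moreover have "?L \<union> ?B \<subseteq> ?G" by (auto simp: light_graphs_def)
    \<comment> \<open>Light graphs have no large component, so a lower bound on their number bounds
      the probability away from 1.\<close>
    ultimately have "card ?L + card ?B \<le> card ?G"
      using fin card_mono[of ?G "?L \<union> ?B"] by (simp add: card_Un_disjoint)
    then have "real (card ?B) \<le> card ?G - card ?L" by linarith
    moreover have "\<delta> * card ?G \<le> card ?L" "\<delta> * card ?G \<le> card ?B"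
      using GB GL Q by (simp_all add: \<delta>_def field_simps)
    ultimately show ?thesis
      unfolding prob using G0 by (simp add: field_simps)
  qed
  ultimately show ?thesis using \<delta> by blast
qed

end
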